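(* Let $R$ be a weakly $\sigma$-distributive Dedekind complete algebra, $(T,d)$ a compact metric space with Borel $\sigma$-algebra $\Sigma$, $\mu:\Sigma\to R$ a positive additive regular mapping, $F:T\to 2^R$ a multifunction and $E\in\Sigma$. If $F$ is convex-valued and the $( * )$-integral $\Phi(F,E)$ is non-empty, then $\Phi(F,E)$ is convex.
   Context: A Riesz space $R$ is Dedekind complete if every nonempty subset bounded from above (below) has a supremum $\bigvee$ (infimum $\bigwedge$) in $R$. A $(D)$-sequence, or regulator, in $R$ is a bounded double sequence $(a_{i,j})_{i,j}$ with $a_{i,j}\ge a_{i,j+1}$ for all $i,j\in\mathbb{N}$ and $\bigwedge_j a_{i,j}=0$ for all $i$. A Dedekind complete $R$ is weakly $\sigma$-distributive if $\bigwedge_{\varphi\in\mathbb{N}^{\mathbb{N}}}\left(\bigvee_{i=1}^{\infty}a_{i,\varphi(i)}\right)=0$ for every $(D)$-sequence. A Dedekind complete Riesz space $R$ is an algebra if it carries a map $\cdot:R\times R\to R$ compatible with sums, order, suprema and infima: it is additive in each variable; if $r\ge s$ and $t\ge0$ then $r\cdot t\ge s\cdot t$ and $t\cdot r\ge t\cdot s$; and if a net $(a_\lambda)$ decreases to $0$ and $b\ge0$ then $b\cdot a_\lambda$ and $a_\lambda\cdot b$ decrease to $0$. $\mu$ is regular if for every $E\in\Sigma$ there is a $(D)$-sequence $(a^E_{i,j})_{i,j}$ such that for every $\varphi:\mathbb{N}\to\mathbb{N}$ there are a compact $K$ and an open $U$ with $K\subset E\subset U$ and $\mu(U\setminus K)\le\bigvee_i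 a^E_{i,\varphi(i)}$. A gage on $T$ is a map $\gamma:T\to\mathbb{R}^+$ (strictly positive reals). A partition of $E\in\Sigma$ is a finite family $\{(E_i,t_i):i=1,\dots,k\}$ with $E_i\in\Sigma$, $t_i\in E_i$, $\mu(E_i\cap E_j)=0$ for $i\ne j$ and $\bigcup_i E_i=E$; it is $\gamma$-fine if $d(w,t_i)<\gamma(t_i)$ for all $i$ and all $w\in E_i$. For $C\subset R$ and $r\in R$, $r\ge 0$, put $\mathcal{U}(C,r)=\{z\in R:\exists x\in C,\ |x-z|\le r\}$, and $\mathrm{cl}(C)=\bigcup_{(a_{i,j})}\bigcap_{\varphi\in\mathbb{N}^{\mathbb{N}}}\mathcal{U}(C,\bigvee_i a_{i,\varphi(i)})$, the union being over all $(D)$-sequences. For sets $A_1,\dots,A_n\subset R$, $\sum_{i=1}^nA_i:=\mathrm{cl}(A_1+\dots+A_n)$ (closure of the algebraic sum); for $C\subset R$ and $r\in R$, $C\,r=\{c\cdot r:c\in C\}$. The $( * )$-integral $\Phi(F,E)$ of $F:T\to2^R$ on $E\in\Sigma$ is the set of all $z\in R$ for which there is a $(D)$-sequence $(a_{i,j})_{i,j}$ such that for all $\varphi\in\mathbb{N}^{\mathbb{N}}$ there is a gage $\gamma$ such that for every $\gamma$-fine partition $\{(E_i,t_i):i=1,\dots,k\}$ of $E$ there is $c\in\sum_{i=1}^kF(t_i)\mu(E_i)$ with $|z-c|\le\bigvee_{i=1}^\infty a_{i,\varphi(i)}$. *)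

theory Defs
  imports "HOL-Analysis.Analysis" "HOL-Library.Lattice_Algebras"
begin

class dedekind_complete_riesz =
  ordered_real_vector + lattice_ab_group_add_abs + conditionally_complete_lattice
begin

text \<open>A regulator, or (D)-sequence. All suprema and infima below are taken over nonempty sets
  that are order bounded, so that \<^const>\<open>Sup\<close> and \<^const>\<open>Inf\<close> are the genuine ones.\<close>

definition regulator :: "(nat \<Rightarrow> nat \<Rightarrow> 'a) \<Rightarrow> bool" where
  "regulator a \<longleftrightarrow>
     (\<exists>b. \<forall>i j. \<bar>a i j\<bar> \<le> b) \<and>
     (\<forall>i j. a i (Suc j) \<le> a i j) \<and>
     (\<forall>i. (INF j. a i j) = 0)"

definition decreasing_to_zero :: "'i set \<Rightarrow> ('i \<Rightarrow> 'i \<Rightarrow> bool) \<Rightarrow> ('i \<Rightarrow> 'a) \<Rightarrow> bool" where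
  "decreasing_to_zero I le x \<longleftrightarrow>
     (I \<noteq> {} \<and> (\<forall>i\<in>I. le i i) \<and>
      (\<forall>i\<in>I. \<forall>j\<in>I. \<forall>k\<in>I. le i j \<longrightarrow> le j k \<longrightarrow> le i k) \<and>
      (\<forall>i\<in>I. \<forall>j\<in>I. \<exists>k\<in>I. le i k \<and> le j k)) \<and>
     (\<forall>i\<in>I. \<forall>j\<in>I. le i j \<longrightarrow> x j \<le> x i) \<and>
     bdd_below (x ` I) \<and> (INF i\<in>I. x i) = 0"

end

class weakly_sigma_distributive_riesz = dedekind_complete_riesz +
  assumes weakly_sigma_distributive:
    "regulator a \<Longrightarrow> (INF \<phi>::nat \<Rightarrow> nat. SUP i. a i (\<phi> i)) = 0"

text \<open>The product is neither assumed associative nor commutative. It suffices to consider nets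
  indexed by subsets of the space itself, since a decreasing net has the same range as the net
  formed by the elements of that range, directed by the reversed order.\<close>

class riesz_algebra = dedekind_complete_riesz + times +
  assumes riesz_add_mult: "(r + s) * t = r * t + s * t"
    and riesz_mult_add: "r * (s + t) = r * s + r * t"
    and riesz_mult_right_mono: "s \<le> r \<Longrightarrow> 0 \<le> t \<Longrightarrow> s * t \<le> r * t"
    and riesz_mult_left_mono: "s \<le> r \<Longrightarrow> 0 \<le> t \<Longrightarrow> t * s \<le> t * r"
    and riesz_mult_net_left:
      "decreasing_to_zero (I :: 'a set) le x \<Longrightarrow> 0 \<le> b \<Longrightarrow> decreasing_to_zero I le (\<lambda>i. b * x i)"
    and riesz_mult_net_right:
      "decreasing_to_zero (I :: 'a set) le x \<Longrightarrow> 0 \<le> b \<Longrightarrow> decreasing_to_zero I le (\<lambda>i. x i * b)"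

definition regular_measure ::
    "('t::topological_space set \<Rightarrow> 'a::dedekind_complete_riesz) \<Rightarrow> bool" where
  "regular_measure \<mu> \<longleftrightarrow>
     (\<forall>E\<in>sets borel. \<exists>a. regulator a \<and>
        (\<forall>\<phi>::nat \<Rightarrow> nat. \<exists>K U. compact K \<and> open U \<and> K \<subseteq> E \<and> E \<subseteq> U \<and>
           \<mu> (U - K) \<le> (SUP i. a i (\<phi> i))))"

text \<open>A partition is a family indexed by \<^term>\<open>{1..k}\<close>; \<^term>\<open>k = 0\<close> occurs only for the empty set.\<close>

definition is_partition ::
    "('t::topological_space set \<Rightarrow> 'a::zero) \<Rightarrow> 't set \<Rightarrow> nat \<Rightarrow> (nat \<Rightarrow> 't set) \<Rightarrow> (nat \<Rightarrow> 't) \<Rightarrow> bool" where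
  "is_partition \<mu> E k A t \<longleftrightarrow>
     (\<forall>i\<in>{1..k}. A i \<in> sets borel \<and> t i \<in> A i) \<and>
     (\<forall>i\<in>{1..k}. \<forall>j\<in>{1..k}. i \<noteq> j \<longrightarrow> \<mu> (A i \<inter> A j) = 0) \<and>
     (\<Union>i\<in>{1..k}. A i) = E"

definition fine_for ::
    "('t::metric_space \<Rightarrow> real) \<Rightarrow> nat \<Rightarrow> (nat \<Rightarrow> 't set) \<Rightarrow> (nat \<Rightarrow> 't) \<Rightarrow> bool" where
  "fine_for \<gamma> k A t \<longleftrightarrow> (\<forall>i\<in>{1..k}. \<forall>w\<in>A i. dist w (t i) < \<gamma> (t i))"

definition order_nbhd :: "'a::dedekind_complete_riesz set \<Rightarrow> 'a \<Rightarrow> 'a set" where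
  "order_nbhd C r = {z. \<exists>x\<in>C. \<bar>x - z\<bar> \<le> r}"

definition order_cl :: "'a::dedekind_complete_riesz set \<Rightarrow> 'a set" where
  "order_cl C = (\<Union>a\<in>{a. regulator a}. \<Inter>\<phi>::nat \<Rightarrow> nat. order_nbhd C (SUP i. a i (\<phi> i)))"

text \<open>The sum inside the closure is the algebraic (Minkowski) sum of sets.\<close>

definition closed_sum :: "nat \<Rightarrow> (nat \<Rightarrow> 'a::dedekind_complete_riesz set) \<Rightarrow> 'a set" where
  "closed_sum n A = order_cl (\<Sum>i=1..n. A i)"

definition star_integral ::
    "('t::metric_space set \<Rightarrow> 'a::riesz_algebra) \<Rightarrow> ('t \<Rightarrow> 'a set) \<Rightarrow> 't set \<Rightarrow> 'a set" where
  "star_integral \<mu> F E =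
     {z. \<exists>a. regulator a \<and>
       (\<forall>\<phi>::nat \<Rightarrow> nat. \<exists>\<gamma>. (\<forall>s. 0 < \<gamma> s) \<and>
         (\<forall>k A t. is_partition \<mu> E k A t \<and> fine_for \<gamma> k A t \<longrightarrow>
            (\<exists>c\<in>closed_sum k (\<lambda>i. (\<lambda>x. x * \<mu> (A i)) ` F (t i)).
               \<bar>z - c\<bar> \<le> (SUP i. a i (\<phi> i)))))}"

end

theory Submission
  imports Defs
begin

text \<open>
  Why the integral is convex. Let \<open>z\<^sub>1\<close> and \<open>z\<^sub>2\<close> lie in the integral and let \<open>u + v = 1\<close> with
  \<open>u, v \<ge> 0\<close>. A partition that is fine for both gages gives points \<open>c\<^sub>1\<close>, \<open>c\<^sub>2\<close> of one and the
  same closed sum, each close to the corresponding \<open>z\<^sub>k\<close>. If that closed sum is convex, then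
  \<open>u c\<^sub>1 + v c\<^sub>2\<close> belongs to it and approximates \<open>u z\<^sub>1 + v z\<^sub>2\<close>.

  Two points carry this argument. The first is that errors are measured by two different
  regulators, while membership asks for a single one. Interleaving the rows of the two regulators
  provides it: a function \<open>\<phi>\<close> on the rows of the interleaved regulator splits into independent
  functions on the rows of the two, and a convex combination of the two resulting suprema is below
  their join, hence below the supremum of the interleaved regulator. This argument is used for
  the integral and again for the convexity of the closure of a convex set; it is isolated in
  \<open>interleaved_error\<close>.

  The second point is that the summands \<open>F(t) \<mu>(A)\<close> are convex. The product is compatible with
  sums and order by definition, but compatibility with real scalars has to be derived: a Dedekind complete
  Riesz space is Archimedean, and in an Archimedean space a monotone additive map is real-linear,
  because integer multiples squeeze the real ones.
\<close>

section \<open>Monotone additive maps are linear\<close>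

text \<open>If \<open>s\<close> is the supremum of the multiples of \<open>y\<close>, then \<open>s - y\<close> is an upper bound of them too, because
  shifting the multiples by \<open>y\<close> stays within them; hence \<open>s \<le> s - y\<close>.\<close>

lemma archimedean_riesz:
  fixes y b :: "'a::dedekind_complete_riesz"
  assumes "\<And>n::nat. real n *\<^sub>R y \<le> b"
  shows "y \<le> 0"
proof -
  define s where "s = (SUP n::nat. real n *\<^sub>R y)"
  have bdd: "bdd_above (range (\<lambda>n::nat. real n *\<^sub>R y))"
    using assms by (auto intro!: bdd_aboveI)
  have "s \<le> s - y"
    unfolding s_def
  proof (rule cSUP_least)
    fix n :: nat
    have "real (Suc n) *\<^sub>R y \<le> (SUP n::nat. real n *\<^sub>R y)"
      using bdd by (rule cSUP_upper2[where x = "Suc n"]) auto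
    then show "real n *\<^sub>R y \<le> (SUP n::nat. real n *\<^sub>R y) - y"
      by (simp add: le_diff_eq scaleR_add_left add.commute)
  qed auto
  then show ?thesis by (simp add: le_diff_eq)
qed

context
  fixes f :: "'a::dedekind_complete_riesz \<Rightarrow> 'b::dedekind_complete_riesz"
  assumes f_add: "\<And>x y. f (x + y) = f x + f y"
    and f_mono: "mono f"
begin

lemma additive_zero: "f 0 = 0"
  using f_add[of 0 0] by simp

lemma additive_minus: "f (- x) = - f x"
  using f_add[of x "- x"] additive_zero by (simp add: minus_unique)

lemma additive_nat_multiple: "f (real n *\<^sub>R x) = real n *\<^sub>R f x"
  by (induction n) (simp_all add: additive_zero f_add scaleR_add_left)

text \<open>Both \<open>n f(c x)\<close> and \<open>n c f(x)\<close> lie between \<open>k f(x)\<close> and \<open>(k + 1) f(x)\<close> for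
  \<open>k = \<lfloor>n c\<rfloor>\<close>. The natural multiples of \<open>f(c x) - c f(x)\<close> and of its negative are
  thus bounded by \<open>f(x)\<close>, which forces the difference to vanish.\<close>

lemma monotone_additive_scaleR_nonneg:
  assumes c: "0 \<le> c" and x: "0 \<le> x"
  shows "f (c *\<^sub>R x) = c *\<^sub>R f x"
proof -
  have fx: "0 \<le> f x"
    using monoD[OF f_mono x] by (simp add: additive_zero)
  have squeeze: "real n *\<^sub>R (f (c *\<^sub>R x) - c *\<^sub>R f x) \<le> f x \<and>
      real n *\<^sub>R (c *\<^sub>R f x - f (c *\<^sub>R x)) \<le> f x" for n :: nat
  proof -
    define k where "k = nat \<lfloor>real n * c\<rfloor>"
    have k: "real k \<le> real n * c" "real n * c \<le> real (Suc k)"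
      unfolding k_def using c by (auto simp: of_nat_floor) linarith
    have lower: "real k *\<^sub>R f x \<le> real n *\<^sub>R f (c *\<^sub>R x)"
      using monoD[OF f_mono scaleR_right_mono[OF k(1) x]]
      by (simp add: additive_nat_multiple flip: scaleR_scaleR)
    have upper: "real n *\<^sub>R f (c *\<^sub>R x) \<le> real (Suc k) *\<^sub>R f x"
      using monoD[OF f_mono scaleR_right_mono[OF k(2) x]]
      by (simp only: additive_nat_multiple flip: scaleR_scaleR)
    have lower': "real k *\<^sub>R f x \<le> real n *\<^sub>R c *\<^sub>R f x"
      using scaleR_right_mono[OF k(1) fx] by simp
    have upper': "real n *\<^sub>R c *\<^sub>R f x \<le> real (Suc k) *\<^sub>R f x"
      using scaleR_right_mono[OF k(2) fx] by simp
    have Suc: "real (Suc k) *\<^sub>R f x = real k *\<^sub>R f x + f x"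
      by (simp add: scaleR_add_left add.commute)
    show ?thesis
      using diff_mono[OF upper lower'] diff_mono[OF upper' lower]
      unfolding Suc scaleR_diff_right by simp
  qed
  show ?thesis
    using archimedean_riesz squeeze by (metis antisym diff_le_0_iff_le)
qed

lemma monotone_additive_scaleR: "f (c *\<^sub>R x) = c *\<^sub>R f x"
proof -
  have nonneg: "f (c *\<^sub>R x) = c *\<^sub>R f x" if c: "0 \<le> c" for c x
  proof -
    have x: "x = sup x 0 + - sup (- x) 0"
      using prts[of x] by (simp add: pprt_def nprt_def neg_sup_eq_inf)
    have "f (c *\<^sub>R x) = f (c *\<^sub>R sup x 0 + - (c *\<^sub>R sup (- x) 0))"
      by (subst x) (simp only: scaleR_add_right scaleR_minus_right)
    also have "\<dots> = c *\<^sub>R f (sup x 0) + - (c *\<^sub>R f (sup (- x) 0))"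
      using c by (simp add: f_add additive_minus monotone_additive_scaleR_nonneg
          del: add_uminus_conv_diff)
    also have "\<dots> = c *\<^sub>R f (sup x 0 + - sup (- x) 0)"
      by (simp only: f_add additive_minus scaleR_add_right scaleR_minus_right)
    finally show ?thesis
      by (simp only: flip: x)
  qed
  show ?thesis
    using nonneg[of c x] nonneg[of "- c" x]
    by (cases "0 \<le> c") (auto simp: additive_minus)
qed

lemma monotone_additive_convex_image: "convex S \<Longrightarrow> convex (f ` S)"
  by (intro convex_linear_image linearI f_add monotone_additive_scaleR)

end

lemma convex_image_mult_right:
  fixes m :: "'a::riesz_algebra"
  assumes "0 \<le> m" "convex S"
  shows "convex ((\<lambda>x. x * m) ` S)"
  using assms by (intro monotone_additive_convex_image)
    (auto simp: riesz_add_mult riesz_mult_right_mono intro: monoI)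

section \<open>Interleaving regulators\<close>

definition interleave :: "(nat \<Rightarrow> 'b) \<Rightarrow> (nat \<Rightarrow> 'b) \<Rightarrow> nat \<Rightarrow> 'b" where
  "interleave a b i = (if even i then a (i div 2) else b (i div 2))"

lemma regulator_interleave:
  fixes a b :: "nat \<Rightarrow> nat \<Rightarrow> 'a::dedekind_complete_riesz"
  assumes "regulator a" "regulator b"
  shows "regulator (interleave a b)"
proof -
  obtain r s where "\<And>i j. \<bar>a i j\<bar> \<le> r" "\<And>i j. \<bar>b i j\<bar> \<le> s"
    using assms unfolding regulator_def by blast
  then have "\<bar>interleave a b i j\<bar> \<le> sup r s" for i j
    by (auto simp: interleave_def intro: le_supI1 le_supI2)
  then have "\<exists>b'. \<forall>i j. \<bar>interleave a b i j\<bar> \<le> b'" by blast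
  then show ?thesis
    using assms unfolding regulator_def by (simp add: interleave_def)
qed

lemma regulator_bdd_above:
  fixes a :: "nat \<Rightarrow> nat \<Rightarrow> 'a::dedekind_complete_riesz"
  assumes "regulator a"
  shows "bdd_above (range (\<lambda>i. a i (\<phi> i)))"
proof -
  obtain r where "\<And>i j. \<bar>a i j\<bar> \<le> r"
    using assms unfolding regulator_def by blast
  then have "a i (\<phi> i) \<le> r" for i
    using abs_ge_self order_trans by blast
  then show ?thesis by (auto intro!: bdd_aboveI)
qed

text \<open>The functions \<open>\<lambda>i. \<phi> (2 * i)\<close> and \<open>\<lambda>i. \<phi> (2 * i + 1)\<close> are the parts of \<open>\<phi>\<close> that act on the
  rows of \<open>a\<close> and of \<open>b\<close>. Since the weights sum to one, no factor appears in front of the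
  regulator.\<close>

lemma interleaved_error:
  fixes a b :: "nat \<Rightarrow> nat \<Rightarrow> 'a::dedekind_complete_riesz"
  assumes reg: "regulator a" "regulator b"
    and uv: "0 \<le> u" "0 \<le> v" "u + v = 1"
    and x: "\<bar>x1 - y1\<bar> \<le> (SUP i. a i (\<phi> (2 * i)))"
    and y: "\<bar>x2 - y2\<bar> \<le> (SUP i. b i (\<phi> (2 * i + 1)))"
  shows "\<bar>(u *\<^sub>R x1 + v *\<^sub>R x2) - (u *\<^sub>R y1 + v *\<^sub>R y2)\<bar> \<le> (SUP i. interleave a b i (\<phi> i))"
    (is "_ \<le> ?S")
proof -
  note bdd = regulator_bdd_above[OF regulator_interleave[OF reg], of \<phi>]
  have "a i (\<phi> (2 * i)) \<le> ?S" for i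
    by (rule cSUP_upper2[OF bdd, of "2 * i"]) (auto simp: interleave_def)
  then have xS: "\<bar>x1 - y1\<bar> \<le> ?S"
    using x by (meson cSUP_least UNIV_not_empty order_trans)
  have "b i (\<phi> (2 * i + 1)) \<le> ?S" for i
    by (rule cSUP_upper2[OF bdd, of "2 * i + 1"]) (auto simp: interleave_def)
  then have yS: "\<bar>x2 - y2\<bar> \<le> ?S"
    using y by (meson cSUP_least UNIV_not_empty order_trans)
  have combine: "u *\<^sub>R p + v *\<^sub>R q \<le> ?S" if "p \<le> ?S" "q \<le> ?S" for p q
  proof -
    have "u *\<^sub>R p + v *\<^sub>R q \<le> u *\<^sub>R ?S + v *\<^sub>R ?S"
      using that uv by (intro add_mono scaleR_left_mono)
    then show ?thesis
      using uv by (simp flip: scaleR_add_left)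
  qed
  have "u *\<^sub>R (x1 - y1) + v *\<^sub>R (x2 - y2) \<le> ?S"
    using xS yS by (intro combine) (auto dest: abs_le_D1)
  moreover have "u *\<^sub>R - (x1 - y1) + v *\<^sub>R - (x2 - y2) \<le> ?S"
    using abs_le_D2[OF xS] abs_le_D2[OF yS] by (rule combine)
  ultimately show ?thesis
    by (intro abs_leI) (simp_all add: algebra_simps)
qed

section \<open>Convexity of closures and of the integral\<close>

lemma convex_order_cl:
  fixes C :: "'a::dedekind_complete_riesz set"
  assumes "convex C"
  shows "convex (order_cl C)"
proof (rule convexI)
  fix x1 x2 :: 'a and u v :: real
  assume x: "x1 \<in> order_cl C" "x2 \<in> order_cl C" and uv: "0 \<le> u" "0 \<le> v" "u + v = 1"
  obtain a where a: "regulator a"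
    "\<And>\<phi>::nat \<Rightarrow> nat. \<exists>y\<in>C. \<bar>y - x1\<bar> \<le> (SUP i. a i (\<phi> i))"
    using x(1) unfolding order_cl_def order_nbhd_def by auto
  obtain b where b: "regulator b"
    "\<And>\<phi>::nat \<Rightarrow> nat. \<exists>y\<in>C. \<bar>y - x2\<bar> \<le> (SUP i. b i (\<phi> i))"
    using x(2) unfolding order_cl_def order_nbhd_def by auto
  have "\<exists>y\<in>C. \<bar>y - (u *\<^sub>R x1 + v *\<^sub>R x2)\<bar> \<le> (SUP i. interleave a b i (\<phi> i))"
    for \<phi> :: "nat \<Rightarrow> nat"
  proof -
    obtain y1 where y1: "y1 \<in> C" "\<bar>y1 - x1\<bar> \<le> (SUP i. a i (\<phi> (2 * i)))"
      using a(2)[of "\<lambda>i. \<phi> (2 * i)"] by blast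
    obtain y2 where y2: "y2 \<in> C" "\<bar>y2 - x2\<bar> \<le> (SUP i. b i (\<phi> (2 * i + 1)))"
      using b(2)[of "\<lambda>i. \<phi> (2 * i + 1)"] by blast
    have "u *\<^sub>R y1 + v *\<^sub>R y2 \<in> C"
      using assms y1(1) y2(1) uv by (rule convexD)
    with interleaved_error[OF a(1) b(1) uv y1(2) y2(2)] show ?thesis by blast
  qed
  then show "u *\<^sub>R x1 + v *\<^sub>R x2 \<in> order_cl C"
    using regulator_interleave[OF a(1) b(1)]
    unfolding order_cl_def order_nbhd_def by blast
qed

lemma convex_closed_sum:
  assumes "\<And>i. i \<in> {1..n} \<Longrightarrow> convex (A i)"
  shows "convex (closed_sum n A)"
  unfolding closed_sum_def using assms by (intro convex_order_cl convex_set_sum) auto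

theorem proposition12:
  fixes \<mu> :: "'t::metric_space set \<Rightarrow> 'a::{weakly_sigma_distributive_riesz, riesz_algebra}"
    and F :: "'t \<Rightarrow> 'a set"
    and E :: "'t set"
  assumes "compact (UNIV :: 't set)"
    and "\<forall>A\<in>sets borel. 0 \<le> \<mu> A"
    and "Measure_Space.additive (sets borel) \<mu>"
    and "regular_measure \<mu>"
    and "E \<in> sets borel"
    and "\<forall>t. convex (F t)"
    and "star_integral \<mu> F E \<noteq> {}"
  shows "convex (star_integral \<mu> F E)"
proof (rule convexI)
  fix z1 z2 :: 'a and u v :: real
  assume z: "z1 \<in> star_integral \<mu> F E" "z2 \<in> star_integral \<mu> F E"
    and uv: "0 \<le> u" "0 \<le> v" "u + v = 1"
  let ?C = "\<lambda>k A t. closed_sum k (\<lambda>i. (\<lambda>x. x * \<mu> (A i)) ` F (t i))"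
  let ?P = "\<lambda>z r \<gamma>. (\<forall>s. 0 < \<gamma> s) \<and> (\<forall>k A t. is_partition \<mu> E k A t \<and> fine_for \<gamma> k A t \<longrightarrow>
            (\<exists>c\<in>?C k A t. \<bar>z - c\<bar> \<le> r))"
  obtain a where a: "regulator a"
    "\<And>\<phi>::nat \<Rightarrow> nat. \<exists>\<gamma>. ?P z1 (SUP i. a i (\<phi> i)) \<gamma>"
    using z(1) unfolding star_integral_def by blast
  obtain b where b: "regulator b"
    "\<And>\<phi>::nat \<Rightarrow> nat. \<exists>\<gamma>. ?P z2 (SUP i. b i (\<phi> i)) \<gamma>"
    using z(2) unfolding star_integral_def by blast
  have "\<exists>\<gamma>. ?P (u *\<^sub>R z1 + v *\<^sub>R z2) (SUP i. interleave a b i (\<phi> i)) \<gamma>" for \<phi> :: "nat \<Rightarrow> nat"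
  proof -
    obtain \<gamma>1 where \<gamma>1: "?P z1 (SUP i. a i (\<phi> (2 * i))) \<gamma>1"
      using a(2)[of "\<lambda>i. \<phi> (2 * i)"] by blast
    obtain \<gamma>2 where \<gamma>2: "?P z2 (SUP i. b i (\<phi> (2 * i + 1))) \<gamma>2"
      using b(2)[of "\<lambda>i. \<phi> (2 * i + 1)"] by blast
    define \<gamma> where "\<gamma> s = min (\<gamma>1 s) (\<gamma>2 s)" for s
    have "\<exists>c\<in>?C k A t. \<bar>(u *\<^sub>R z1 + v *\<^sub>R z2) - c\<bar> \<le> (SUP i. interleave a b i (\<phi> i))"
      if part: "is_partition \<mu> E k A t" and fine: "fine_for \<gamma> k A t" for k A t
    proof -
      have "fine_for \<gamma>1 k A t" "fine_for \<gamma>2 k A t"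
        using fine by (auto simp: fine_for_def \<gamma>_def)
      with part \<gamma>1 \<gamma>2 obtain c1 c2
        where c1: "c1 \<in> ?C k A t" "\<bar>z1 - c1\<bar> \<le> (SUP i. a i (\<phi> (2 * i)))"
          and c2: "c2 \<in> ?C k A t" "\<bar>z2 - c2\<bar> \<le> (SUP i. b i (\<phi> (2 * i + 1)))"
        by meson
      have "convex (?C k A t)"
        using part assms(2,6)
        by (intro convex_closed_sum convex_image_mult_right) (auto simp: is_partition_def)
      then have "u *\<^sub>R c1 + v *\<^sub>R c2 \<in> ?C k A t"
        using c1(1) c2(1) uv by (rule convexD)
      with interleaved_error[OF a(1) b(1) uv c1(2) c2(2)] show ?thesis by blast
    qed
    moreover have "\<forall>s. 0 < \<gamma> s"
      using \<gamma>1 \<gamma>2 by (simp add: \<gamma>_def)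
    ultimately show ?thesis by blast
  qed
  then show "u *\<^sub>R z1 + v *\<^sub>R z2 \<in> star_integral \<mu> F E"
    using regulator_interleave[OF a(1) b(1)] unfolding star_integral_def by blast
qed

end
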